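(* Let $p>0$ be an integer, and let $T^p(n,k)$ ($n\ge 0$, $0\le k\le n$) be the integers defined in the context. Then for every integer $n>0$, $$\sum_{k=0}^{n}T^p(n,k)=A^p_n,\qquad\text{where}\qquad A^p_n=\frac{1}{pn+1}\binom{pn+1}{n}.$$
   Context: The numbers $A^p_n=\frac{1}{pn+1}\binom{pn+1}{n}$ are the Fuss-Catalan numbers. For every integer $p>0$, the integers $T^p(n,k)$, for $n\ge 0$ and $0\le k\le n$, are defined by the initial conditions $T^p(0,0)=1$ and $T^p(n,n)=0$ for $n>0$, and by the recurrence, for $n>0$ and $0\le k<n$, $$T^p(n,k)=\sum_{j=0}^{k}\binom{k-j+p-2}{p-2}\,T^p(n-1,j).$$ Convention for $p=1$: $\binom{m-1}{-1}$ is understood to be $1$ if $m=0$ and $0$ if $m>0$, so that the recurrence reads $T^1(n,k)=T^1(n-1,k)$, giving $T^1(n,0)=1$ for $n>0$ and $T^1(n,k)=0$ for $k>0$. *)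

theory Defs
  imports Complex_Main
begin

definition fuss_catalan :: "nat \<Rightarrow> nat \<Rightarrow> real" where
  "fuss_catalan p n = 1 / (real p * real n + 1) * real ((p * n + 1) choose n)"

(* The binomial coefficient (m + p - 2 over p - 2) for p > 0. For p = 1 it is (m - 1 over -1),
   which is 1 for m = 0 and 0 for m > 0 by convention; natural-number subtraction would
   give 1 for every m there. *)
definition fc_coeff :: "nat \<Rightarrow> nat \<Rightarrow> nat" where
  "fc_coeff p m =
     (if p = 1 then (if m = 0 then 1 else 0) else (m + p - 2) choose (p - 2))"

(* The numbers T^p(n, k) are only meaningful for p > 0 and k \<le> n; the entries with k > n,
   which the recurrence never uses, are set to 0. *)
fun fc_T :: "nat \<Rightarrow> nat \<Rightarrow> nat \<Rightarrow> int" where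
  "fc_T p 0 k = (if k = 0 then 1 else 0)"
| "fc_T p (Suc n) k =
     (if k < Suc n then \<Sum>j=0..k. int (fc_coeff p (k - j)) * fc_T p n j else 0)"

end

theory Submission
  imports Defs "HOL-Computational_Algebra.Formal_Power_Series"
begin

unbundle fps_syntax

text \<open>Put \<open>W = 1/(1 - X)\<close> and \<open>q = p - 1\<close>. The recurrence multiplies the generating series of a
  row by \<open>W ^ q\<close> and cuts it off. The cut does no harm: for \<open>n > 0\<close> the series
  \<open>W ^ (q * n) - q * X * W ^ (q * n + 1)\<close> is obtained from the preceding one by multiplying with
  \<open>W ^ q\<close>, and its coefficient at \<open>X ^ n\<close> vanishes by itself, so its first \<open>n + 1\<close> coefficients are
  the \<open>n\<close>-th row. Multiplying once more with \<open>W\<close> sums the row.\<close>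

lemma Suc_times_binomial_Suc: "Suc k * (N choose Suc k) = (N - k) * (N choose k)"
  by (simp only: binomial_absorption binomial_absorb_comp)

abbreviation geometric_fps :: "real fps" where
  "geometric_fps \<equiv> Abs_fps (\<lambda>_. 1)"

text \<open>Multiplying by \<open>W\<close> forms partial sums, so the induction step is the
  hockey-stick identity.\<close>

lemma geometric_fps_power_nth:
  "(geometric_fps ^ Suc a) $ k = real ((a + k) choose k)"
proof (induction a arbitrary: k)
  case 0
  then show ?case by simp
next
  case (Suc a)
  have "(geometric_fps ^ Suc (Suc a)) $ k = (\<Sum>i=0..k. (geometric_fps ^ Suc a) $ i)"
    by (subst power_Suc2) (simp only: fps_mult_nth fps_nth_Abs_fps mult_1_right)
  also have "\<dots> = real (\<Sum>i\<le>k. (a + i) choose i)"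
    by (simp only: Suc.IH of_nat_sum atMost_atLeast0)
  finally show ?case by (simp only: sum_choose_lower add_Suc)
qed

text \<open>The convention for \<open>p = 1\<close> is exactly \<open>W ^ 0 = 1\<close>; the other
  case is the symmetry of binomials.\<close>

lemma fc_coeff_conv_fps:
  assumes "p > 0"
  shows "real (fc_coeff p m) = (geometric_fps ^ (p - 1)) $ m"
proof (cases "p = 1")
  case True
  then show ?thesis by (simp add: fc_coeff_def)
next
  case False
  then obtain a where p: "p = Suc (Suc a)"
    using assms by (metis One_nat_def not0_implies_Suc less_numeral_extra(3))
  have "(m + a) choose a = (a + m) choose m"
    using binomial_symmetric[of m "a + m"] by (simp add: add.commute)
  then show ?thesis
    using geometric_fps_power_nth[of a m] by (simp add: fc_coeff_def p)
qed

text \<open>This is \<open>W ^ (q * n)\<close> times the fixed series \<open>1 - q * X * W\<close>.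
  That factor is forced: its constant term is row 0, and each vanishing diagonal entry determines
  one further coefficient.\<close>

definition row_fps :: "nat \<Rightarrow> nat \<Rightarrow> real fps" where
  "row_fps q n = geometric_fps ^ (q * n)
     - fps_const (real q) * fps_X * geometric_fps ^ Suc (q * n)"

lemma row_fps_Suc: "row_fps q (Suc n) = row_fps q n * geometric_fps ^ q"
  by (simp add: row_fps_def power_add algebra_simps)

text \<open>The two terms contribute adjacent binomials with the same upper index, whose ratio is
  \<open>q * Suc n / Suc n = q\<close>.\<close>

lemma row_fps_diagonal: "row_fps q (Suc n) $ Suc n = 0"
proof (cases q)
  case 0
  then show ?thesis by (simp add: row_fps_def)
next
  case (Suc r)
  \<comment> \<open>For \<open>q > 0\<close> the exponent is a successor, as
    \<open>geometric_fps_power_nth\<close> requires.\<close>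
  define b where "b = r + q * n"
  have b: "q * Suc n = Suc b"
    using Suc by (simp add: b_def)
  have "Suc n * ((b + Suc n) choose Suc n) = Suc b * ((Suc b + n) choose n)"
    using Suc_times_binomial_Suc[of n "b + Suc n"] by simp
  also have "\<dots> = Suc n * (q * ((Suc b + n) choose n))"
    by (simp only: b[symmetric]) (simp only: ac_simps)
  finally have *: "(b + Suc n) choose Suc n = q * ((Suc b + n) choose n)"
    by (simp only: nat_mult_eq_cancel1 zero_less_Suc)
  have "row_fps q (Suc n) $ Suc n =
      (geometric_fps ^ Suc b) $ Suc n - real q * (geometric_fps ^ Suc (Suc b)) $ n"
    by (simp only: row_fps_def b fps_sub_nth mult.assoc fps_mult_left_const_nth
        fps_X_mult_nth) simp
  then show ?thesis
    by (simp only: geometric_fps_power_nth * of_nat_mult)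
qed

lemma fc_T_conv_fps:
  assumes "p > 0"
  shows "k \<le> Suc n \<Longrightarrow> real_of_int (fc_T p (Suc n) k) = row_fps (p - 1) (Suc n) $ k"
proof (induction n arbitrary: k)
  case 0
  show ?case
  proof (cases "k = 0")
    case True
    then show ?thesis
      using fc_coeff_conv_fps[OF assms, of 0] by (simp add: row_fps_def mult.assoc)
  next
    case False
    then have "k = Suc 0" using 0 by simp
    then show ?thesis by (simp only: row_fps_diagonal) simp
  qed
next
  case (Suc n)
  show ?case
  proof (cases "k = Suc (Suc n)")
    case True
    then show ?thesis by (simp only: row_fps_diagonal) simp
  next
    case False
    then have k: "k < Suc (Suc n)" using Suc.prems by simp
    have "real_of_int (fc_T p (Suc (Suc n)) k) =
        (\<Sum>j=0..k. real_of_int (fc_T p (Suc n) j) * real (fc_coeff p (k - j)))"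
      using k by (simp del: fc_T.simps add: fc_T.simps(2)[of p "Suc n"] mult.commute)
    \<comment> \<open>Here \<open>j\<close> can reach \<open>Suc n\<close>, so the induction
      hypothesis must include the diagonal entry of the previous row.\<close>
    also have "\<dots> = (\<Sum>j=0..k. row_fps (p - 1) (Suc n) $ j * (geometric_fps ^ (p - 1)) $ (k - j))"
      using k by (intro sum.cong refl) (simp add: Suc.IH fc_coeff_conv_fps[OF assms] del: fc_T.simps)
    finally show ?thesis by (simp only: row_fps_Suc[of _ "Suc n"] fps_mult_nth)
  qed
qed

lemma sum_row_fps:
  "(\<Sum>k=0..Suc m. row_fps q (Suc m) $ k) =
     real ((q * Suc m + Suc m) choose Suc m) - real q * real ((q * Suc m + Suc m) choose m)"
proof -
  have "(\<Sum>k=0..Suc m. row_fps q (Suc m) $ k) = (row_fps q (Suc m) * geometric_fps) $ Suc m"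
    by (simp only: fps_mult_nth fps_nth_Abs_fps mult_1_right)
  also have "row_fps q (Suc m) * geometric_fps =
      geometric_fps ^ Suc (q * Suc m)
      - fps_const (real q) * (fps_X * geometric_fps ^ Suc (Suc (q * Suc m)))"
    by (simp add: row_fps_def algebra_simps)
  also have "\<dots> $ Suc m = (geometric_fps ^ Suc (q * Suc m)) $ Suc m
      - real q * (geometric_fps ^ Suc (Suc (q * Suc m))) $ m"
    by (simp only: fps_sub_nth fps_mult_left_const_nth fps_X_mult_nth) simp
  \<comment> \<open>The shift by \<open>X\<close> is offset by the extra factor \<open>W\<close>, so
    both binomials have the same upper index.\<close>
  finally show ?thesis
    by (simp only: geometric_fps_power_nth add_Suc add_Suc_right)
qed

theorem proposition2:
  fixes p n :: nat
  assumes "p > 0" and "n > 0"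
  shows "(\<Sum>k=0..n. real_of_int (fc_T p n k)) = fuss_catalan p n"
proof -
  obtain m q where n: "n = Suc m" and p: "p = Suc q"
    using assms by (metis not0_implies_Suc less_numeral_extra(3))
  define N where "N = q * Suc m + Suc m"
  have N: "p * n = N" by (simp add: N_def n p)
  have "(\<Sum>k=0..n. real_of_int (fc_T p n k)) = (\<Sum>k=0..Suc m. row_fps q (Suc m) $ k)"
    unfolding n using fc_T_conv_fps[OF assms(1), of _ m] p
    by (intro sum.cong refl) (simp del: fc_T.simps)
  also have "\<dots> = real (N choose Suc m) - real q * real (N choose m)"
    by (simp only: sum_row_fps N_def)
  \<comment> \<open>Multiplied by \<open>n\<close>, the first term is \<open>q * n + 1\<close>
    copies of \<open>N choose m\<close> and the second \<open>q * n\<close> copies, so one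
    remains.\<close>
  also have "\<dots> = real (N choose m) / real n"
  proof -
    have "Suc m * (N choose Suc m) = (N - m) * (N choose m)"
      by (rule Suc_times_binomial_Suc)
    also have "N - m = q * n + 1" by (simp add: N_def n)
    finally have "real n * real (N choose Suc m) = (real q * real n + 1) * real (N choose m)"
      unfolding n by (metis of_nat_mult of_nat_add of_nat_1)
    then show ?thesis using assms(2) by (simp add: field_simps)
  qed
  also have "\<dots> = 1 / (real N + 1) * real (Suc N choose n)"
  proof -
    have "real n * real (Suc N choose n) = (real N + 1) * real (N choose m)"
      unfolding n using Suc_times_binomial_eq[of N m]
      by (metis mult.commute of_nat_Suc of_nat_mult add.commute)
    then show ?thesis using assms(2) by (simp add: field_simps add_pos_nonneg)
  qed
  finally show ?thesis
    by (simp add: fuss_catalan_def N flip: of_nat_mult)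
qed

end
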